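(* Let $R$ be a noetherian integral domain (commutative) and let $S\subseteq R$ be a prime-generated submonoid of the multiplicative monoid of $R$. If the localization $S^{-1}R$ is a unique factorization domain, then $R$ is a unique factorization domain.
   Context: A submonoid $S\subseteq R$ (containing $1$ and closed under multiplication) is called prime-generated if every $s\in S$ can be written as a finite product $s=q_1\cdots q_n$ (with $n\ge 0$, the empty product being $1$) in which each $q_i$ satisfies $q_i\in S$ and $q_i$ is a prime element of $R$. $S^{-1}R$ denotes the ring of fractions $a/s$ with $a\in R$, $s\in S$. *)

theory Defs
  imports "HOL-Algebra.Ring_Divisibility"
begin

definition prime_generated :: "'a set \<Rightarrow> ('a, 'b) ring_scheme \<Rightarrow> bool" where
  "prime_generated S R \<longleftrightarrow>
     submonoid S R \<and>
     (\<forall>s\<in>S. \<exists>qs. (\<forall>q\<in>set qs. q \<in> S \<and> ring_prime\<^bsub>R\<^esub> q) \<and> s = foldr (\<otimes>\<^bsub>R\<^esub>) qs \<one>\<^bsub>R\<^esub>)"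

text \<open>
  The ring of fractions is constructed for an arbitrary multiplicative subset of a commutative
  ring, hence the extra factor \<open>u\<close> below; in a domain with \<open>\<zero> \<notin> S\<close> it can be cancelled.
  The class of \<open>(a, s)\<close> is the fraction \<open>a/s\<close>. The operations are given by representatives;
  their independence of the choice is established in \<open>fraction_mult\<close> and \<open>fraction_add\<close>.
\<close>

definition fraction_rel :: "('a, 'b) ring_scheme \<Rightarrow> 'a set \<Rightarrow> (('a \<times> 'a) \<times> ('a \<times> 'a)) set" where
  "fraction_rel R S =
     {((a, s), (b, t)) | a s b t. a \<in> carrier R \<and> s \<in> S \<and> b \<in> carrier R \<and> t \<in> S \<and>
        (\<exists>u\<in>S. u \<otimes>\<^bsub>R\<^esub> (a \<otimes>\<^bsub>R\<^esub> t) = u \<otimes>\<^bsub>R\<^esub> (b \<otimes>\<^bsub>R\<^esub> s))}"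

definition fraction :: "('a, 'b) ring_scheme \<Rightarrow> 'a set \<Rightarrow> 'a \<Rightarrow> 'a \<Rightarrow> ('a \<times> 'a) set" where
  "fraction R S a s = fraction_rel R S `` {(a, s)}"

definition localization :: "('a, 'b) ring_scheme \<Rightarrow> 'a set \<Rightarrow> ('a \<times> 'a) set ring" where
  "localization R S =
     \<lparr> carrier = (carrier R \<times> S) // fraction_rel R S,
       mult = (\<lambda>X Y. \<Union>(a, s)\<in>X. \<Union>(b, t)\<in>Y. fraction R S (a \<otimes>\<^bsub>R\<^esub> b) (s \<otimes>\<^bsub>R\<^esub> t)),
       one = fraction R S \<one>\<^bsub>R\<^esub> \<one>\<^bsub>R\<^esub>,
       zero = fraction R S \<zero>\<^bsub>R\<^esub> \<one>\<^bsub>R\<^esub>,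
       add = (\<lambda>X Y. \<Union>(a, s)\<in>X. \<Union>(b, t)\<in>Y.
                fraction R S ((a \<otimes>\<^bsub>R\<^esub> t) \<oplus>\<^bsub>R\<^esub> (b \<otimes>\<^bsub>R\<^esub> s)) (s \<otimes>\<^bsub>R\<^esub> t)) \<rparr>"

context cring
begin

context
  fixes S
  assumes S: "submonoid S R"
begin

private lemma Sc: "s \<in> S \<Longrightarrow> s \<in> carrier R"
  using S by (rule submonoid.mem_carrier)

private lemma Sm: "s \<in> S \<Longrightarrow> t \<in> S \<Longrightarrow> s \<otimes> t \<in> S"
  using S by (rule submonoid.m_closed)

private lemma S1: "\<one> \<in> S"
  using S by (rule submonoid.one_closed)

lemma fraction_rel_iff:
  "((a, s), (b, t)) \<in> fraction_rel R S \<longleftrightarrow>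
     a \<in> carrier R \<and> s \<in> S \<and> b \<in> carrier R \<and> t \<in> S \<and> (\<exists>u\<in>S. u \<otimes> (a \<otimes> t) = u \<otimes> (b \<otimes> s))"
  by (auto simp: fraction_rel_def)

lemma equiv_fraction_rel: "equiv (carrier R \<times> S) (fraction_rel R S)"
proof (rule equivI)
  show "fraction_rel R S \<subseteq> (carrier R \<times> S) \<times> (carrier R \<times> S)"
    by (auto simp: fraction_rel_def)
  show "refl_on (carrier R \<times> S) (fraction_rel R S)"
    using S1 by (auto simp: refl_on_def fraction_rel_iff)
  show "sym (fraction_rel R S)"
    by (auto simp: sym_def fraction_rel_iff) metis
  show "trans (fraction_rel R S)"
  proof (clarsimp simp: trans_def fraction_rel_iff)
    fix a s b t c r u v
    assume c [simp]: "a \<in> carrier R" "b \<in> carrier R" "c \<in> carrier R"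
      and m: "s \<in> S" "t \<in> S" "r \<in> S" "u \<in> S" "v \<in> S"
      and 1: "u \<otimes> (a \<otimes> t) = u \<otimes> (b \<otimes> s)" and 2: "v \<otimes> (b \<otimes> r) = v \<otimes> (c \<otimes> t)"
    note [simp] = m[THEN Sc]
    have "(u \<otimes> v \<otimes> t) \<otimes> (a \<otimes> r) = (v \<otimes> r) \<otimes> (u \<otimes> (a \<otimes> t))"
      by (simp add: m_ac)
    also have "\<dots> = (u \<otimes> s) \<otimes> (v \<otimes> (b \<otimes> r))"
      unfolding 1 by (simp add: m_ac)
    also have "\<dots> = (u \<otimes> v \<otimes> t) \<otimes> (c \<otimes> s)"
      unfolding 2 by (simp add: m_ac)
    finally show "\<exists>u\<in>S. u \<otimes> (a \<otimes> r) = u \<otimes> (c \<otimes> s)"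
      using Sm m by blast
  qed
qed

lemma fraction_eq_iff:
  assumes "a \<in> carrier R" "s \<in> S" "b \<in> carrier R" "t \<in> S"
  shows "fraction R S a s = fraction R S b t \<longleftrightarrow> (\<exists>u\<in>S. u \<otimes> (a \<otimes> t) = u \<otimes> (b \<otimes> s))"
  unfolding fraction_def
  using eq_equiv_class_iff[OF equiv_fraction_rel, of "(a, s)" "(b, t)"] assms
  by (simp add: fraction_rel_iff)

lemma fraction_closed:
  "a \<in> carrier R \<Longrightarrow> s \<in> S \<Longrightarrow> fraction R S a s \<in> carrier (localization R S)"
  by (auto simp: localization_def fraction_def intro: quotientI)

lemma fraction_cases:
  assumes "X \<in> carrier (localization R S)"
  obtains a s where "a \<in> carrier R" "s \<in> S" "X = fraction R S a s"
  using assms by (auto simp: localization_def fraction_def elim!: quotientE)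

lemma fraction_mult:
  assumes "a \<in> carrier R" "s \<in> S" "b \<in> carrier R" "t \<in> S"
  shows "fraction R S a s \<otimes>\<^bsub>localization R S\<^esub> fraction R S b t = fraction R S (a \<otimes> b) (s \<otimes> t)"
proof -
  have "(\<lambda>x y. case x of (a, s) \<Rightarrow> case y of (b, t) \<Rightarrow> fraction R S (a \<otimes> b) (s \<otimes> t))
          respects2 fraction_rel R S"
  proof (rule congruent2I', clarsimp simp: fraction_rel_iff)
    fix a s a' s' b t b' t' u v
    assume c: "a \<in> carrier R" "a' \<in> carrier R" "b \<in> carrier R" "b' \<in> carrier R"
      and m: "s \<in> S" "s' \<in> S" "t \<in> S" "t' \<in> S" "u \<in> S" "v \<in> S"
      and 1: "u \<otimes> (a \<otimes> s') = u \<otimes> (a' \<otimes> s)" and 2: "v \<otimes> (b \<otimes> t') = v \<otimes> (b' \<otimes> t)"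
    note [simp] = c m[THEN Sc]
    have "(u \<otimes> v) \<otimes> ((a \<otimes> b) \<otimes> (s' \<otimes> t')) = (u \<otimes> (a \<otimes> s')) \<otimes> (v \<otimes> (b \<otimes> t'))"
      by (simp add: m_ac)
    also have "\<dots> = (u \<otimes> v) \<otimes> ((a' \<otimes> b') \<otimes> (s \<otimes> t))"
      unfolding 1 2 by (simp add: m_ac)
    finally show "fraction R S (a \<otimes> b) (s \<otimes> t) = fraction R S (a' \<otimes> b') (s' \<otimes> t')"
      using Sm m by (subst fraction_eq_iff) auto
  qed
  from UN_equiv_class2[OF equiv_fraction_rel equiv_fraction_rel this, of "(a, s)" "(b, t)"] assms
  show ?thesis
    by (simp add: localization_def fraction_def case_prod_unfold)
qed

lemma fraction_add:
  assumes "a \<in> carrier R" "s \<in> S" "b \<in> carrier R" "t \<in> S"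
  shows "fraction R S a s \<oplus>\<^bsub>localization R S\<^esub> fraction R S b t =
           fraction R S ((a \<otimes> t) \<oplus> (b \<otimes> s)) (s \<otimes> t)"
proof -
  have "(\<lambda>x y. case x of (a, s) \<Rightarrow> case y of (b, t) \<Rightarrow>
            fraction R S ((a \<otimes> t) \<oplus> (b \<otimes> s)) (s \<otimes> t)) respects2 fraction_rel R S"
  proof (rule congruent2I', clarsimp simp: fraction_rel_iff)
    fix a s a' s' b t b' t' u v
    assume c: "a \<in> carrier R" "a' \<in> carrier R" "b \<in> carrier R" "b' \<in> carrier R"
      and m: "s \<in> S" "s' \<in> S" "t \<in> S" "t' \<in> S" "u \<in> S" "v \<in> S"
      and 1: "u \<otimes> (a \<otimes> s') = u \<otimes> (a' \<otimes> s)" and 2: "v \<otimes> (b \<otimes> t') = v \<otimes> (b' \<otimes> t)"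
    note [simp] = c m[THEN Sc]
    have "(u \<otimes> v) \<otimes> (((a \<otimes> t) \<oplus> (b \<otimes> s)) \<otimes> (s' \<otimes> t')) =
            (v \<otimes> (t \<otimes> t')) \<otimes> (u \<otimes> (a \<otimes> s')) \<oplus> (u \<otimes> (s \<otimes> s')) \<otimes> (v \<otimes> (b \<otimes> t'))"
      by (simp add: l_distr r_distr m_ac)
    also have "\<dots> = (u \<otimes> v) \<otimes> (((a' \<otimes> t') \<oplus> (b' \<otimes> s')) \<otimes> (s \<otimes> t))"
      unfolding 1 2 by (simp add: l_distr r_distr m_ac)
    finally show "fraction R S ((a \<otimes> t) \<oplus> (b \<otimes> s)) (s \<otimes> t) =
                    fraction R S ((a' \<otimes> t') \<oplus> (b' \<otimes> s')) (s' \<otimes> t')"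
      using Sm m by (subst fraction_eq_iff) auto
  qed
  from UN_equiv_class2[OF equiv_fraction_rel equiv_fraction_rel this, of "(a, s)" "(b, t)"] assms
  show ?thesis
    by (simp add: localization_def fraction_def case_prod_unfold)
qed

lemma localization_one: "\<one>\<^bsub>localization R S\<^esub> = fraction R S \<one> \<one>"
  by (simp add: localization_def)

lemma localization_zero: "\<zero>\<^bsub>localization R S\<^esub> = fraction R S \<zero> \<one>"
  by (simp add: localization_def)

private lemma fraction_cong:
  assumes "a \<in> carrier R" "s \<in> S" "b \<in> carrier R" "t \<in> S" "a \<otimes> t = b \<otimes> s"
  shows "fraction R S a s = fraction R S b t"
  using assms S1 by (subst fraction_eq_iff) auto

lemma localization_is_cring: "cring (localization R S)"
proof (rule cringI)
  note ops = fraction_add fraction_mult localization_one localization_zero fraction_closed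
    Sc Sm S1
  show "abelian_group (localization R S)"
  proof (rule abelian_groupI)
    fix X Y Z
    assume "X \<in> carrier (localization R S)" "Y \<in> carrier (localization R S)"
      "Z \<in> carrier (localization R S)"
    then show "X \<oplus>\<^bsub>localization R S\<^esub> Y \<oplus>\<^bsub>localization R S\<^esub> Z =
        X \<oplus>\<^bsub>localization R S\<^esub> (Y \<oplus>\<^bsub>localization R S\<^esub> Z)"
      by (elim fraction_cases)
         (auto simp: ops l_distr r_distr m_ac a_ac intro!: fraction_cong)
  next
    fix X assume "X \<in> carrier (localization R S)"
    then obtain a s where X: "a \<in> carrier R" "s \<in> S" "X = fraction R S a s"
      by (rule fraction_cases)
    have "fraction R S (\<ominus> a) s \<oplus>\<^bsub>localization R S\<^esub> X = \<zero>\<^bsub>localization R S\<^esub>"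
      using X by (simp add: ops l_minus l_neg) (rule fraction_cong; simp add: Sc Sm S1)
    with X show "\<exists>Y\<in>carrier (localization R S). Y \<oplus>\<^bsub>localization R S\<^esub> X = \<zero>\<^bsub>localization R S\<^esub>"
      by (intro bexI[of _ "fraction R S (\<ominus> a) s"]) (auto simp: ops)
  qed (auto elim!: fraction_cases simp: ops m_ac a_ac)
  show "Group.comm_monoid (localization R S)"
    by (rule comm_monoidI) (auto elim!: fraction_cases simp: ops m_ac)
  fix X Y Z
  assume "X \<in> carrier (localization R S)" "Y \<in> carrier (localization R S)"
    "Z \<in> carrier (localization R S)"
  then show "(X \<oplus>\<^bsub>localization R S\<^esub> Y) \<otimes>\<^bsub>localization R S\<^esub> Z =
      X \<otimes>\<^bsub>localization R S\<^esub> Z \<oplus>\<^bsub>localization R S\<^esub> Y \<otimes>\<^bsub>localization R S\<^esub> Z"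
    by (elim fraction_cases)
       (simp add: ops, rule fraction_cong; simp add: ops l_distr r_distr m_ac)
qed

end

end

end

theory Submission
  imports Defs
begin

text \<open>
  This is Nagata's factoriality criterion. A noetherian domain has factorizations into irreducible
  elements, so it is factorial as soon as every irreducible element \<open>p\<close> is prime.

  Let \<open>p\<close> be irreducible. If \<open>p\<close> divides an element of \<open>S\<close>, which is a product of
  primes from \<open>S\<close>, then \<open>p\<close> is associated to one of them (\<open>irreducible_divisor_prime\<close>).

  Otherwise, \<open>p\<close> is compared with the fraction \<open>p/1\<close>. The tool is that every \<open>s\<close> in \<open>S\<close> is
  \<^emph>\<open>primal\<close>: if \<open>s\<close> divides \<open>a b\<close>, its prime factors can be cancelled one after the other,
  each against \<open>a\<close> or against \<open>b\<close>, so that \<open>s = u v\<close> with \<open>u\<close>, \<open>v\<close> in \<open>S\<close> dividing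
  \<open>a\<close> and \<open>b\<close> respectively (\<open>prime_generated_primal\<close>). So a factorization of \<open>p/1\<close> in the
  localization can be cleared of denominators into a factorization of \<open>p\<close>, and \<open>p/1\<close> is
  irreducible (\<open>fraction_irreducible\<close>), hence prime because the localization is factorial.
  Primality of \<open>p/1\<close> descends to \<open>p\<close> (\<open>fraction_prime_imp_prime\<close>), because if \<open>p\<close>
  divides \<open>r a\<close> with \<open>r\<close> in \<open>S\<close>, then \<open>p\<close> already divides \<open>a\<close>
  (\<open>irreducible_divides_cancel\<close>).
\<close>

section \<open>Factoriality of noetherian domains\<close>

lemma (in noetherian_domain) factorial_domainI:
  assumes "\<And>p. p \<in> carrier R \<Longrightarrow> ring_irreducible p \<Longrightarrow> ring_prime p"
  shows "factorial_domain R"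
proof -
  interpret P: primeness_condition_monoid "mult_of R"
  proof
    fix p assume "p \<in> carrier (mult_of R)" "irreducible (mult_of R) p"
    then show "prime (mult_of R) p"
      using assms[of p] ring_irreducibleI'[of p] ring_primeE(2)[of p] by auto
  qed
  have "factorial_monoid (mult_of R)"
    using factorization_property P.wfactors_unique by (intro mult_of.factorial_monoidI) auto
  then show ?thesis
    by (intro factorial_domain.intro domain_axioms)
qed

section \<open>Prime-generated submonoids\<close>

context domain
begin

context
  fixes S
  assumes pg: "prime_generated S R"
begin

private lemma sub: "submonoid S R"
  using pg by (simp add: prime_generated_def)

private lemma S_carrier: "s \<in> S \<Longrightarrow> s \<in> carrier R"
  using sub by (rule submonoid.mem_carrier)

private lemma S_mult: "s \<in> S \<Longrightarrow> t \<in> S \<Longrightarrow> s \<otimes> t \<in> S"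
  using sub by (rule submonoid.m_closed)

private lemma S_one: "\<one> \<in> S"
  using sub by (rule submonoid.one_closed)

lemma prime_generated_induct [consumes 1, case_names one mult]:
  assumes "s \<in> S" "P \<one>"
    and step: "\<And>q s. q \<in> S \<Longrightarrow> ring_prime q \<Longrightarrow> s \<in> S \<Longrightarrow> P s \<Longrightarrow> P (q \<otimes> s)"
  shows "P s"
proof -
  have "foldr (\<otimes>) qs \<one> \<in> S \<and> P (foldr (\<otimes>) qs \<one>)"
    if "\<forall>q\<in>set qs. q \<in> S \<and> ring_prime q" for qs
    using that by (induction qs) (auto simp: assms(2) S_one S_mult intro: step)
  moreover obtain qs where "\<forall>q\<in>set qs. q \<in> S \<and> ring_prime q" "s = foldr (\<otimes>) qs \<one>"
    using assms(1) pg unfolding prime_generated_def by metis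
  ultimately show ?thesis
    by simp
qed

lemma prime_generated_nonzero: "s \<in> S \<Longrightarrow> s \<noteq> \<zero>"
  by (induction rule: prime_generated_induct) (auto simp: integral_iff S_carrier ring_prime_def)

text \<open>
  A prime factor \<open>q\<close> of \<open>s\<close> divides \<open>a\<close> or \<open>b\<close>; cancelling it leaves an equation of the same
  form with one prime factor less.
\<close>

lemma prime_generated_primal:
  assumes "s \<in> S" "a \<in> carrier R" "b \<in> carrier R" "x \<in> carrier R" "s \<otimes> x = a \<otimes> b"
  obtains u v a' b' where "u \<in> S" "v \<in> S" "a' \<in> carrier R" "b' \<in> carrier R"
    "s = u \<otimes> v" "a = u \<otimes> a'" "b = v \<otimes> b'" "x = a' \<otimes> b'"
proof -
  have "\<exists>u\<in>S. \<exists>v\<in>S. \<exists>a'\<in>carrier R. \<exists>b'\<in>carrier R.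
      s = u \<otimes> v \<and> a = u \<otimes> a' \<and> b = v \<otimes> b' \<and> x = a' \<otimes> b'"
    using assms
  proof (induction arbitrary: a b rule: prime_generated_induct)
    case one
    then show ?case
      using S_one by force
  next
    case (mult q s)
    note [simp] = mult.hyps(1,3)[THEN S_carrier] mult.prems(1-3)
    have q0: "q \<noteq> \<zero>"
      using mult.hyps(2) by (simp add: ring_prime_def)
    have eq: "q \<otimes> (s \<otimes> x) = a \<otimes> b"
      using mult.prems(4) by (simp add: m_assoc)
    then have "q divides a \<otimes> b"
      by (metis dividesI m_closed mult.prems(3) S_carrier mult.hyps(3))
    then consider "q divides a" | "q divides b"
      using mult.hyps(2) mult.prems unfolding ring_prime_def prime_def by blast
    then show ?case
    proof cases
      case 1
      then obtain c where c [simp]: "c \<in> carrier R" and a: "a = q \<otimes> c"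
        by (auto simp: factor_def)
      have "q \<otimes> (s \<otimes> x) = q \<otimes> (c \<otimes> b)"
        using eq a by (simp add: m_assoc)
      then have "s \<otimes> x = c \<otimes> b"
        using q0 by (simp add: m_lcancel)
      then obtain u v a' b' where *: "u \<in> S" "v \<in> S" "a' \<in> carrier R" "b' \<in> carrier R"
          "s = u \<otimes> v" "c = u \<otimes> a'" "b = v \<otimes> b'" "x = a' \<otimes> b'"
        using mult.IH[of c b] by auto
      then have "q \<otimes> s = (q \<otimes> u) \<otimes> v" "a = (q \<otimes> u) \<otimes> a'"
        using a by (simp_all add: m_assoc S_carrier)
      with * mult.hyps(1) show ?thesis
        using S_mult by blast
    next
      case 2
      then obtain c where c [simp]: "c \<in> carrier R" and b: "b = q \<otimes> c"
        by (auto simp: factor_def)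
      have "q \<otimes> (s \<otimes> x) = q \<otimes> (a \<otimes> c)"
        using eq b by (simp add: m_lcomm)
      then have "s \<otimes> x = a \<otimes> c"
        using q0 by (simp add: m_lcancel)
      then obtain u v a' b' where *: "u \<in> S" "v \<in> S" "a' \<in> carrier R" "b' \<in> carrier R"
          "s = u \<otimes> v" "a = u \<otimes> a'" "c = v \<otimes> b'" "x = a' \<otimes> b'"
        using mult.IH[of a c] by auto
      then have "q \<otimes> s = u \<otimes> (q \<otimes> v)" "b = (q \<otimes> v) \<otimes> b'"
        using b by (simp_all add: m_ac S_carrier)
      with * mult.hyps(1) show ?thesis
        using S_mult by blast
    qed
  qed
  then show ?thesis
    using that by blast
qed

text \<open>
  Cancelling the prime factors \<open>q\<close> of the multiple of \<open>p\<close> one by one, either some \<open>q\<close> divides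
  \<open>p\<close>, so that \<open>p\<close> is associated to \<open>q\<close>, or all of them go into the cofactor and \<open>p\<close> divides
  \<open>\<one>\<close>.
\<close>

lemma irreducible_divisor_prime:
  assumes "s \<in> S" "p \<in> carrier R" "ring_irreducible p" "p divides s"
  shows "ring_prime p"
  using assms
proof (induction rule: prime_generated_induct)
  case one
  then show ?case
    using divides_one ring_irreducibleE(4) by blast
next
  case (mult q s)
  note [simp] = mult.hyps(1,3)[THEN S_carrier] mult.prems(1)
  have q0: "q \<noteq> \<zero>" and qp: "prime R q"
    using mult.hyps(2) by (simp_all add: ring_prime_def)
  obtain c where c [simp]: "c \<in> carrier R" and eq: "q \<otimes> s = p \<otimes> c"
    using mult.prems(3) by (auto simp: factor_def)
  have "q divides p \<otimes> c"
    using eq by (metis dividesI S_carrier mult.hyps(3))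
  then consider "q divides p" | "q divides c"
    using qp mult.prems(1) c unfolding prime_def by blast
  then show ?case
  proof cases
    case 1
    then have "q \<sim> p"
      using divides_irreducible_condition[of R p q] mult.prems(2) qp
      by (auto simp: ring_irreducible_def prime_def)
    then have "q \<sim>\<^bsub>mult_of R\<^esub> p"
      by (simp add: assoc_iff_assoc_mult)
    then have "prime (mult_of R) p"
      using mult_of.prime_cong[of q p] mult.hyps(2) q0 ring_primeE(2)[of q]
        ring_irreducibleE(1)[OF mult.prems(1,2)] by simp
    then show ?thesis
      using ring_primeI'[of p] ring_irreducibleE(1)[OF mult.prems(1,2)] by simp
  next
    case 2
    then obtain d where d [simp]: "d \<in> carrier R" and "c = q \<otimes> d"
      by (auto simp: factor_def)
    then have "q \<otimes> s = q \<otimes> (p \<otimes> d)"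
      using eq by (simp add: m_lcomm)
    then have "s = p \<otimes> d"
      using q0 by (simp add: m_lcancel)
    then have "p divides s"
      using d by (auto simp: factor_def)
    with mult.IH mult.prems show ?thesis
      by simp
  qed
qed

section \<open>Divisibility in the localization\<close>

lemma fraction_eq_iff_cross_mult:
  assumes "a \<in> carrier R" "s \<in> S" "b \<in> carrier R" "t \<in> S"
  shows "fraction R S a s = fraction R S b t \<longleftrightarrow> a \<otimes> t = b \<otimes> s"
proof -
  have "u \<otimes> (a \<otimes> t) = u \<otimes> (b \<otimes> s) \<longleftrightarrow> a \<otimes> t = b \<otimes> s" if "u \<in> S" for u
    using that assms by (simp add: m_lcancel S_carrier prime_generated_nonzero)
  then show ?thesis
    using S_one assms by (auto simp: fraction_eq_iff[OF sub])
qed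

lemma fraction_divides_iff:
  assumes [simp]: "a \<in> carrier R" "b \<in> carrier R" and S: "s \<in> S" "t \<in> S"
  shows "fraction R S a s divides\<^bsub>localization R S\<^esub> fraction R S b t \<longleftrightarrow>
    (\<exists>r\<in>S. a divides r \<otimes> b)"
proof
  assume "fraction R S a s divides\<^bsub>localization R S\<^esub> fraction R S b t"
  then obtain c r where c: "c \<in> carrier R" "r \<in> S"
    and "fraction R S b t = fraction R S a s \<otimes>\<^bsub>localization R S\<^esub> fraction R S c r"
    unfolding factor_def by (metis fraction_cases[OF sub])
  then have "b \<otimes> (s \<otimes> r) = (a \<otimes> c) \<otimes> t"
    using S by (simp add: fraction_mult[OF sub] fraction_eq_iff_cross_mult S_mult)
  then have "(s \<otimes> r) \<otimes> b = a \<otimes> (c \<otimes> t)"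
    using S c by (simp add: m_ac S_carrier)
  then show "\<exists>r\<in>S. a divides r \<otimes> b"
    using S c S_mult S_carrier by (metis dividesI m_closed)
next
  assume "\<exists>r\<in>S. a divides r \<otimes> b"
  then obtain r c where r: "r \<in> S" and c [simp]: "c \<in> carrier R" and eq: "r \<otimes> b = a \<otimes> c"
    by (auto simp: factor_def)
  note [simp] = r[THEN S_carrier] S[THEN S_carrier]
  have "b \<otimes> (s \<otimes> (r \<otimes> t)) = (s \<otimes> t) \<otimes> (r \<otimes> b)"
    by (simp add: m_ac)
  also have "\<dots> = a \<otimes> (c \<otimes> s) \<otimes> t"
    unfolding eq by (simp add: m_ac)
  finally have "fraction R S b t =
      fraction R S a s \<otimes>\<^bsub>localization R S\<^esub> fraction R S (c \<otimes> s) (r \<otimes> t)"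
    using S r by (simp add: fraction_mult[OF sub] fraction_eq_iff_cross_mult S_mult)
  then show "fraction R S a s divides\<^bsub>localization R S\<^esub> fraction R S b t"
    using S r by (intro dividesI[of "fraction R S (c \<otimes> s) (r \<otimes> t)"])
      (simp_all add: fraction_closed[OF sub] S_mult)
qed

lemma fraction_Units_iff:
  assumes "a \<in> carrier R" "s \<in> S"
  shows "fraction R S a s \<in> Units (localization R S) \<longleftrightarrow> (\<exists>r\<in>S. a divides r)"
proof -
  interpret L: cring "localization R S"
    using sub by (rule localization_is_cring)
  show ?thesis
    using L.divides_one[of "fraction R S a s"] assms S_one
    by (simp add: fraction_closed[OF sub] localization_one[OF sub] fraction_divides_iff S_carrier
        cong: bex_cong)
qed

section \<open>Irreducible and prime elements of the localization\<close>

text \<open>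
  A factorization of \<open>p/1\<close> becomes, after clearing denominators, \<open>(s t) p = a b\<close>. Splitting
  \<open>s t\<close> between \<open>a\<close> and \<open>b\<close> leaves a factorization of \<open>p\<close>, and a factor that is a unit there
  makes the corresponding numerator a divisor of an element of \<open>S\<close>.
\<close>

lemma fraction_irreducible:
  assumes L: "domain (localization R S)"
    and p: "p \<in> carrier R" "ring_irreducible p" and no: "\<And>s. s \<in> S \<Longrightarrow> \<not> p divides s"
  shows "ring_irreducible\<^bsub>localization R S\<^esub> (fraction R S p \<one>)"
proof (rule domain.ring_irreducibleI[OF L])
  have "fraction R S p \<one> \<noteq> \<zero>\<^bsub>localization R S\<^esub>"
    using p ring_irreducibleE(1)[OF p]
    by (simp add: localization_zero[OF sub] fraction_eq_iff_cross_mult S_one)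
  then show "fraction R S p \<one> \<in> carrier (localization R S) - {\<zero>\<^bsub>localization R S\<^esub>}"
    using p by (simp add: fraction_closed[OF sub] S_one)
  show "fraction R S p \<one> \<notin> Units (localization R S)"
    using p no by (auto simp: fraction_Units_iff S_one)
next
  have unit_numerator: "fraction R S (u \<otimes> a) s \<in> Units (localization R S)"
    if "u \<in> S" "s \<in> S" "a \<in> Units R" for u a s
  proof -
    have "u \<otimes> a divides u"
      using that by (intro dividesI[of "inv a"]) (simp_all add: m_assoc S_carrier Units_closed)
    then show ?thesis
      using that by (auto simp: fraction_Units_iff S_carrier Units_closed)
  qed
  fix X Y
  assume "X \<in> carrier (localization R S)" "Y \<in> carrier (localization R S)"
    and eq: "fraction R S p \<one> = X \<otimes>\<^bsub>localization R S\<^esub> Y"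
  then obtain a s b t where X: "a \<in> carrier R" "s \<in> S" "X = fraction R S a s"
    and Y: "b \<in> carrier R" "t \<in> S" "Y = fraction R S b t"
    by (metis fraction_cases[OF sub])
  have "(s \<otimes> t) \<otimes> p = a \<otimes> b"
    using eq X Y p
    by (simp add: fraction_mult[OF sub] fraction_eq_iff_cross_mult S_mult S_one S_carrier m_comm)
  then obtain u v a' b' where *: "u \<in> S" "v \<in> S" "a' \<in> carrier R" "b' \<in> carrier R"
      "s \<otimes> t = u \<otimes> v" "a = u \<otimes> a'" "b = v \<otimes> b'" "p = a' \<otimes> b'"
    by (rule prime_generated_primal[OF S_mult[OF X(2) Y(2)] X(1) Y(1) p(1)])
  then have "a' \<in> Units R \<or> b' \<in> Units R"
    using ring_irreducibleE(5)[OF p] by blast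
  then show "X \<in> Units (localization R S) \<or> Y \<in> Units (localization R S)"
    using unit_numerator * X Y by blast
qed

text \<open>
  Splitting \<open>r\<close> in \<open>r a = p c\<close> removes from \<open>p\<close> a factor in \<open>S\<close>. As \<open>p\<close> is irreducible
  and does not divide that factor, the factor is a unit.
\<close>

lemma irreducible_divides_cancel:
  assumes p: "p \<in> carrier R" "ring_irreducible p" and no: "\<And>s. s \<in> S \<Longrightarrow> \<not> p divides s"
    and a: "a \<in> carrier R" and r: "r \<in> S" "p divides r \<otimes> a"
  shows "p divides a"
proof -
  obtain c where c: "c \<in> carrier R" "r \<otimes> a = p \<otimes> c"
    using r(2) by (auto simp: factor_def)
  obtain u v p' c' where uv: "u \<in> S" "v \<in> S" and [simp]: "p' \<in> carrier R" "c' \<in> carrier R"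
    and "r = u \<otimes> v" and p_eq: "p = u \<otimes> p'" and "c = v \<otimes> c'" and a_eq: "a = p' \<otimes> c'"
    by (rule prime_generated_primal[OF r(1) p(1) c(1) a c(2)])
  note [simp] = uv(1)[THEN S_carrier]
  have "p' \<notin> Units R"
  proof
    assume "p' \<in> Units R"
    then have "u = p \<otimes> inv p'" "inv p' \<in> carrier R"
      using p_eq by (simp_all add: m_assoc)
    then show False
      using no[OF uv(1)] by (auto simp: factor_def)
  qed
  then have u: "u \<in> Units R"
    using ring_irreducibleE(5)[OF p _ _ p_eq] by auto
  have "p \<otimes> (inv u \<otimes> c') = (u \<otimes> inv u) \<otimes> (p' \<otimes> c')"
    using u p_eq by (simp add: m_ac del: Units_r_inv)
  then have "a = p \<otimes> (inv u \<otimes> c')"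
    using u a_eq by simp
  then show ?thesis
    using u by (intro dividesI[of "inv u \<otimes> c'"]) simp_all
qed

lemma fraction_prime_imp_prime:
  assumes p: "p \<in> carrier R" "ring_irreducible p" and no: "\<And>s. s \<in> S \<Longrightarrow> \<not> p divides s"
    and prime: "prime (localization R S) (fraction R S p \<one>)"
  shows "ring_prime p"
proof (rule ring_primeI)
  show "p \<noteq> \<zero>"
    using ring_irreducibleE(1)[OF p] .
  show "prime R p"
  proof (rule primeI)
    show "p \<notin> Units R"
      using ring_irreducibleE(4)[OF p] .
    fix a b assume ab: "a \<in> carrier R" "b \<in> carrier R" "p divides a \<otimes> b"
    then have "fraction R S p \<one> divides\<^bsub>localization R S\<^esub>
        fraction R S a \<one> \<otimes>\<^bsub>localization R S\<^esub> fraction R S b \<one>"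
      using p S_one by (auto simp: fraction_mult[OF sub] fraction_divides_iff intro!: bexI[of _ \<one>])
    then have "fraction R S p \<one> divides\<^bsub>localization R S\<^esub> fraction R S a \<one> \<or>
        fraction R S p \<one> divides\<^bsub>localization R S\<^esub> fraction R S b \<one>"
      using prime ab fraction_closed[OF sub] S_one unfolding prime_def by blast
    then show "p divides a \<or> p divides b"
      using ab p S_one irreducible_divides_cancel[OF p no] by (auto simp: fraction_divides_iff)
  qed
qed

end

end

section \<open>Nagata's criterion\<close>

theorem theorem3p3:
  fixes R (structure)
  assumes "noetherian_domain R"
    and "prime_generated S R"
    and "factorial_domain (localization R S)"
  shows "factorial_domain R"
proof -
  interpret noetherian_domain R by fact
  interpret L: factorial_domain "localization R S" by fact
  have one: "\<one> \<in> S"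
    using assms(2) by (simp add: prime_generated_def submonoid.one_closed)
  have closed: "fraction R S a \<one> \<in> carrier (localization R S)" if "a \<in> carrier R" for a
    using assms(2) one that by (simp add: prime_generated_def fraction_closed)
  show ?thesis
  proof (rule factorial_domainI)
    fix p assume p: "p \<in> carrier R" "ring_irreducible p"
    show "ring_prime p"
    proof (cases "\<exists>s\<in>S. p divides s")
      case True
      then show ?thesis
        using irreducible_divisor_prime[OF assms(2)] p by blast
    next
      case False
      let ?p = "fraction R S p \<one>"
      have irr: "ring_irreducible\<^bsub>localization R S\<^esub> ?p"
        using fraction_irreducible[OF assms(2) L.domain_axioms p] False by blast
      then have "prime (mult_of (localization R S)) ?p"
        using L.irreducible_prime[of ?p] L.ring_irreducibleE(1,3)[of ?p] closed p by simp
      then have "prime (localization R S) ?p"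
        using L.prime_eq_prime_mult closed p by blast
      then show ?thesis
        using fraction_prime_imp_prime[OF assms(2) p] False by blast
    qed
  qed
qed

end
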